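(* Let $n\in\mathbb{N}$ and let $g:\mathbb{R}^n\to\mathbb{R}$ be Borel measurable such that for all $x,y\in\mathbb{R}^n$, if $x_i\le y_i$ for $i=1,\dots,n$ then $g(x)\le g(y)$. Let $f=(f_1,\dots,f_n)\in\mathcal{B}_R^n$ be an $n$-tuple of right tail bounds, and let $\widetilde{X}=(\widetilde{X}_1,\dots,\widetilde{X}_n):(0,1)^n\to\mathbb{R}^n$, $\widetilde X(s_1,\dots,s_n)=(\widetilde X_1(s_1),\dots,\widetilde X_n(s_n))$, where $\widetilde{X}_k(s)=\sup f_k^{-1}[1-s,1]$ for $s\in(0,1)$. Then $$\sup_{X\in\mathcal{T}_R(f)}P(g(X)\ge t)=P(g(\widetilde{X})\ge t)\qquad\text{for all }t\in\mathbb{R}.$$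
   Context: All sets carry the Borel $\sigma$-algebra; $(0,1)^n$ carries Lebesgue measure, which is the probability measure $P$ for random variables with domain $(0,1)^n$. A real random variable is neat if it is a monotonically increasing (nondecreasing) function $X:(0,1)\to\mathbb{R}$; $\mathcal{N}$ is the set of neat random variables. $\mathcal{N}^n$ is the set of product random variables $X=(X_1,\dots,X_n):(0,1)^n\to\mathbb{R}^n$, $X(s_1,\dots,s_n)=(X_1(s_1),\dots,X_n(s_n))$, with $X_1,\dots,X_n\in\mathcal{N}$ (so the components are mutually independent). $\mathcal{B}_R$ is the set of functions $f:\mathbb{R}\to[0,1]$ that are monotonically decreasing (nonincreasing), left continuous, with $\lim_{t\to-\infty}f(t)=1$ and $\lim_{t\to\infty}f(t)=0$. For $f=(f_1,\dots,f_n)\in\mathcal{B}_R^n$, $\mathcal{T}_R(f)=\{X\in\mathcal{N}^n : P(X_k\ge t)\le f_k(t)\ \forall t\in\mathbb{R},\ k=1,\dots,n\}$. *)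

theory Defs
  imports "HOL-Probability.Probability"
begin

definition interval_prob :: "real measure" where
  "interval_prob = restrict_space lborel {0<..<1}"

definition cube_prob :: "(real ^ 'n) measure" where
  "cube_prob = restrict_space lborel {s. \<forall>k. s $ k \<in> {0<..<1}}"

text \<open>A function on $(0,1)$ is represented by a total function on the reals whose values
  outside $(0,1)$ are unconstrained and never used.\<close>

definition neat :: "(real \<Rightarrow> real) set" where
  "neat = {X. mono_on {0<..<1} X}"

definition product_rv :: "('n \<Rightarrow> real \<Rightarrow> real) \<Rightarrow> real ^ 'n \<Rightarrow> real ^ 'n" where
  "product_rv X s = (\<chi> k. X k (s $ k))"

definition right_tail_bounds :: "(real \<Rightarrow> real) set" where
  "right_tail_bounds =
     {f. range f \<subseteq> {0..1} \<and> antimono f \<and> (\<forall>t. continuous (at_left t) f) \<and>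
         (f \<longlongrightarrow> 1) at_bot \<and> (f \<longlongrightarrow> 0) at_top}"

definition right_tail_class :: "('n \<Rightarrow> real \<Rightarrow> real) \<Rightarrow> (real ^ 'n \<Rightarrow> real ^ 'n) set" where
  "right_tail_class f =
     {product_rv X | X. (\<forall>k. X k \<in> neat) \<and>
        (\<forall>t k. \<P>(s in interval_prob. X k s \<ge> t) \<le> f k t)}"

text \<open>For a right tail bound \<open>f\<close> and $s \in (0,1)$ the set below is nonempty and bounded above,
  so the supremum is a genuine real supremum.\<close>

definition right_tail_extremal :: "(real \<Rightarrow> real) \<Rightarrow> real \<Rightarrow> real" where
  "right_tail_extremal f s = Sup (f -` {1 - s..1})"

end

theory Submission
  imports Defs
begin

text \<open>A nondecreasing \<open>X\<close> satisfies \<open>X \<ge> X s\<close> on \<open>[s, 1)\<close>, so a tail bound forces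
  \<open>f (X s) \<ge> 1 - s\<close>: the extremal variable dominates every admissible one at each point of the
  cube, not just in distribution. By left continuity of \<open>f\<close> it is itself admissible, so for
  nondecreasing \<open>g\<close> the supremum is attained there.\<close>

lemma space_interval_prob [simp]: "space interval_prob = {0<..<1}"
  by (simp add: interval_prob_def space_restrict_space)

lemma space_cube_prob [simp]: "space cube_prob = {s. \<forall>k. s $ k \<in> {0<..<1}}"
  by (simp add: cube_prob_def space_restrict_space)

lemma unit_cube_eq_box: "{s :: real ^ 'n. \<forall>k. s $ k \<in> {0<..<1}} = box 0 1"
  by (auto simp: mem_box_cart)

lemma finite_measure_interval_prob: "finite_measure interval_prob"
  by (rule finite_measureI) (simp add: interval_prob_def space_restrict_space emeasure_restrict_space)

lemma finite_measure_cube_prob: "finite_measure (cube_prob :: (real ^ 'n) measure)"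
proof (rule finite_measureI)
  have "emeasure (cube_prob :: (real ^ 'n) measure) (space cube_prob)
      = emeasure lborel (box 0 1 :: (real ^ 'n) set)"
    unfolding cube_prob_def unit_cube_eq_box
    by (simp add: space_restrict_space emeasure_restrict_space)
  then show "emeasure (cube_prob :: (real ^ 'n) measure) (space cube_prob) \<noteq> \<infinity>"
    using emeasure_lborel_box_finite[of 0 "1 :: real ^ 'n"] by simp
qed

lemma measurable_neat:
  assumes "X \<in> neat"
  shows "X \<in> borel_measurable interval_prob"
proof -
  have "X \<in> borel_measurable (restrict_space borel {0<..<1})"
    using assms by (auto simp: neat_def intro: borel_measurable_mono_on_fnc)
  then show ?thesis
    by (simp add: interval_prob_def cong: measurable_cong_sets sets_restrict_space_cong)
qed

lemma measurable_cube_coord: "(\<lambda>s. s $ k) \<in> cube_prob \<rightarrow>\<^sub>M interval_prob"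
  unfolding cube_prob_def interval_prob_def
  by (rule measurable_restrict_space3) auto

text \<open>Each component is a coordinate projection followed by a monotone function, and
  measurability into a Euclidean space is checked componentwise.\<close>

lemma measurable_product_rv:
  fixes X :: "'n::finite \<Rightarrow> real \<Rightarrow> real"
  assumes "\<And>k. X k \<in> neat"
  shows "product_rv X \<in> borel_measurable cube_prob"
  unfolding borel_measurable_euclidean_space[of "product_rv X"]
  using measurable_compose[OF measurable_cube_coord measurable_neat[OF assms]]
  by (auto simp: Basis_vec_def inner_axis product_rv_def)

context
  fixes f :: "real \<Rightarrow> real"
  assumes f: "f \<in> right_tail_bounds"
begin

lemma right_tail_bounds_antimono: "x \<le> y \<Longrightarrow> f y \<le> f x"
  using f by (auto simp: right_tail_bounds_def antimono_def)

lemma right_tail_bounds_range: "0 \<le> f x" "f x \<le> 1"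
  using f by (auto simp: right_tail_bounds_def image_subset_iff)

text \<open>The limit 1 at minus infinity pushes \<open>f\<close> above \<open>1 - s\<close>, which
  is less than 1 because \<open>s\<close> is positive.\<close>

lemma right_tail_level_set_nonempty:
  assumes "0 < s"
  shows "f -` {1 - s..1} \<noteq> {}"
proof -
  have "(f \<longlongrightarrow> 1) at_bot"
    using f by (simp add: right_tail_bounds_def)
  then have "\<forall>\<^sub>F x in at_bot. 1 - s < f x"
    using assms by (intro order_tendstoD(1)) auto
  then obtain x where "1 - s < f x"
    by (metis eventually_at_bot_linorder order_refl)
  then have "x \<in> f -` {1 - s..1}"
    using right_tail_bounds_range(2)[of x] by simp
  then show ?thesis by blast
qed

text \<open>The limit 0 at infinity gives a point \<open>b\<close> with \<open>f b < 1 - s\<close>;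
  as \<open>f\<close> is nonincreasing, \<open>b\<close> bounds the whole level set.\<close>

lemma bdd_above_right_tail_level_set:
  assumes "s < 1"
  shows "bdd_above (f -` {1 - s..1})"
proof -
  have "(f \<longlongrightarrow> 0) at_top"
    using f by (simp add: right_tail_bounds_def)
  then have "\<forall>\<^sub>F x in at_top. f x < 1 - s"
    using assms by (intro order_tendstoD(2)) auto
  then obtain b where "f b < 1 - s"
    by (metis eventually_at_top_linorder order_refl)
  then have "x \<le> b" if "x \<in> f -` {1 - s..1}" for x
    using right_tail_bounds_antimono[of b x] that by (cases "x \<le> b") auto
  then show ?thesis by (rule bdd_aboveI)
qed

lemma right_tail_extremal_upper:
  assumes "s < 1" "1 - s \<le> f x"
  shows "x \<le> right_tail_extremal f s"
  unfolding right_tail_extremal_def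
  using assms right_tail_bounds_range(2)[of x]
  by (intro cSup_upper bdd_above_right_tail_level_set) auto

text \<open>The level sets grow with \<open>s\<close>, hence so do their suprema.\<close>

lemma right_tail_extremal_neat: "right_tail_extremal f \<in> neat"
  unfolding neat_def right_tail_extremal_def
  by (auto intro!: mono_onI cSup_subset_mono right_tail_level_set_nonempty
      bdd_above_right_tail_level_set)

text \<open>Converse to \<open>right_tail_extremal_upper\<close>, and the place where left
  continuity enters: every \<open>u < t\<close> lies below a point of the level set, so
  \<open>1 - s \<le> f u\<close> by monotonicity, and the inequality survives the limit from the
  left at \<open>t\<close>.\<close>

lemma right_tail_extremal_geD:
  assumes "0 < s" "t \<le> right_tail_extremal f s"
  shows "1 - s \<le> f t"
proof (rule tendsto_lowerbound)
  show "(f \<longlongrightarrow> f t) (at_left t)"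
    using f by (auto simp: right_tail_bounds_def continuous_within)
  show "\<forall>\<^sub>F u in at_left t. 1 - s \<le> f u"
    unfolding eventually_at_filter
  proof (intro always_eventually allI impI)
    fix u assume "u \<in> {..<t}"
    then have "u < Sup (f -` {1 - s..1})"
      using assms by (simp add: right_tail_extremal_def)
    then obtain v where "u < v" "1 - s \<le> f v"
      using less_cSupD[OF right_tail_level_set_nonempty[OF assms(1)]] by fastforce
    then show "1 - s \<le> f u"
      using right_tail_bounds_antimono[of u v] by simp
  qed
qed simp

text \<open>By \<open>right_tail_extremal_geD\<close> the event lies in \<open>{1 - f t..1}\<close>,
  an interval of length \<open>f t\<close>.\<close>

lemma prob_right_tail_extremal_le:
  "\<P>(s in interval_prob. right_tail_extremal f s \<ge> t) \<le> f t"
proof -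
  note [measurable] = measurable_neat[OF right_tail_extremal_neat]
  have "{s \<in> space interval_prob. right_tail_extremal f s \<ge> t} \<in> sets interval_prob"
    by measurable
  \<comment> \<open>The comparison takes place in \<open>lborel\<close>, because the enclosing
    interval contains 1 and so leaves the open unit interval.\<close>
  then have "{s \<in> {0<..<1}. right_tail_extremal f s \<ge> t} \<in> sets lborel"
    by (simp add: interval_prob_def space_restrict_space sets_restrict_space_iff)
  moreover have "\<P>(s in interval_prob. right_tail_extremal f s \<ge> t)
      = measure lborel {s \<in> {0<..<1}. right_tail_extremal f s \<ge> t}"
    by (subst interval_prob_def, subst measure_restrict_space) auto
  moreover have "measure lborel {1 - f t..1} = f t"
    using right_tail_bounds_range[of t] by simp
  moreover have "{s \<in> {0<..<1}. right_tail_extremal f s \<ge> t} \<subseteq> {1 - f t..1}"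
    using right_tail_extremal_geD[of _ t] by fastforce
  moreover have "{1 - f t..1} \<in> fmeasurable lborel"
    using fmeasurable_cbox[of "1 - f t" 1] by simp
  ultimately show ?thesis
    using measure_mono_fmeasurable by metis
qed

text \<open>The tail bound is applied at the single level \<open>X s\<close>, which places
  \<open>X s\<close> in the level set whose supremum is the extremal value.\<close>

lemma neat_le_right_tail_extremal:
  assumes X: "X \<in> neat" and tail: "\<And>t. \<P>(s in interval_prob. X s \<ge> t) \<le> f t"
    and s: "s \<in> {0<..<1}"
  shows "X s \<le> right_tail_extremal f s"
proof (rule right_tail_extremal_upper)
  interpret finite_measure interval_prob by (rule finite_measure_interval_prob)
  note [measurable] = measurable_neat[OF X]
  have "1 - s = measure interval_prob {s..<1}"
    using s by (subst interval_prob_def, subst measure_restrict_space) auto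
  also have "\<dots> \<le> \<P>(u in interval_prob. X u \<ge> X s)"
  proof (rule finite_measure_mono)
    show "{s..<1} \<subseteq> {u \<in> space interval_prob. X u \<ge> X s}"
      using X s by (auto simp: neat_def mono_on_def)
  qed measurable
  also have "\<dots> \<le> f (X s)" by (rule tail)
  finally show "1 - s \<le> f (X s)" .
qed (use s in simp)

end

lemma product_rv_extremal_in_right_tail_class:
  assumes "\<And>k. f k \<in> right_tail_bounds"
  shows "product_rv (\<lambda>k. right_tail_extremal (f k)) \<in> right_tail_class f"
  unfolding right_tail_class_def
  using right_tail_extremal_neat[OF assms] prob_right_tail_extremal_le[OF assms] by blast

theorem theorem2p2p1:
  fixes g :: "real ^ 'n \<Rightarrow> real"
    and f :: "'n::finite \<Rightarrow> real \<Rightarrow> real"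
    and t :: real
  assumes "g \<in> borel_measurable borel"
    and "\<And>x y. (\<And>i. x $ i \<le> y $ i) \<Longrightarrow> g x \<le> g y"
    and "\<And>k. f k \<in> right_tail_bounds"
  shows "(SUP X\<in>right_tail_class f. \<P>(s in cube_prob. g (X s) \<ge> t)) =
         \<P>(s in cube_prob. g (product_rv (\<lambda>k. right_tail_extremal (f k)) s) \<ge> t)"
\<comment> \<open>An upper bound that belongs to the set is its supremum; this settles nonemptiness
  and boundedness of the set at once.\<close>
proof (rule cSup_eq_maximum)
  let ?E = "product_rv (\<lambda>k. right_tail_extremal (f k))"
  show "\<P>(s in cube_prob. g (?E s) \<ge> t) \<in> (\<lambda>X. \<P>(s in cube_prob. g (X s) \<ge> t)) ` right_tail_class f"
    by (rule imageI) (rule product_rv_extremal_in_right_tail_class[OF assms(3)])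
  fix p assume "p \<in> (\<lambda>X. \<P>(s in cube_prob. g (X s) \<ge> t)) ` right_tail_class f"
  then obtain X where p: "p = \<P>(s in cube_prob. g (product_rv X s) \<ge> t)"
    and X: "\<And>k. X k \<in> neat" "\<And>u k. \<P>(s in interval_prob. X k s \<ge> u) \<le> f k u"
    by (auto simp: right_tail_class_def)
  interpret finite_measure "cube_prob :: (real ^ 'n) measure"
    by (rule finite_measure_cube_prob)
  \<comment> \<open>The final comparison of nested events by \<open>finite_measure_mono\<close> asks
    for measurability of the larger one, the event for \<open>?E\<close>.\<close>
  have [measurable]: "?E \<in> borel_measurable cube_prob"
    by (intro measurable_product_rv right_tail_extremal_neat assms(3))
  note [measurable] = assms(1)
  have "g (product_rv X s) \<le> g (?E s)" if "s \<in> space cube_prob" for s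
    using that neat_le_right_tail_extremal[OF assms(3) X]
    by (intro assms(2)) (simp add: product_rv_def)
  then show "p \<le> \<P>(s in cube_prob. g (?E s) \<ge> t)"
    unfolding p by (intro finite_measure_mono) (force, measurable)
qed

end
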